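(* Let $G=(V,E)$ be the side information graph of an index coding problem, let $e\in E$, and let $G_e=(V,E\setminus\{e\})$. If $e$ is critical for $G$, then one of the following holds: 1) $e$ belongs to a unicycle, or 2) $e$ does not belong to a unicycle and the MAIS bound is not tight for $G_e$.
   Context: Index coding problem: let $n\ge 1$ and $[1:n]=\{1,\dots,n\}$. An index coding problem is specified by side information subsets $A_1,\dots,A_n$ with $A_j\subseteq[1:n]\setminus\{j\}$, or equivalently by its side information graph $G=(V,E)$, the directed graph (no self-loops, no parallel edges) with $V=[1:n]$ and an edge $i\to j$ if and only if $i\in A_j$. Index code: for nonnegative integers $t_1,\dots,t_n$ and a positive integer $r$, a $(t_1,\dots,t_n,r)$ index code for $G$ consists of an encoder $\phi:\prod_{i=1}^n\{0,1\}^{t_i}\to\{0,1\}^r$ and decoders $\psi_j:\{0,1\}^r\times\prod_{k\in A_j}\{0,1\}^{t_k}\to\{0,1\}^{t_j}$, $j\in[1:n]$, such that $\psi_j(\phi(x^n),(x_k)_{k\in A_j})=x_j$ for all $j\in[1:n]$ and all $x^n=(x_1,\dots,x_n)\in\prod_{i=1}^n\{0,1\}^{t_i}$. Capacity region: a tuple $(R_1,\dots,R_n)$ of nonnegative reals is achievable for $G$ if there exists a $(t_1,\dots,t_n,r)$ index code for $G$ with $R_j\le t_j/r$ for all $j\in[1:n]$. The capacity region of $G$ is the closure of the set of achievable rate tuples. Critical edge: an edge $e\in E$ is critical for $G$ if the capacity region of $G_e$ is a proper subset of the capacity region of $G$. For $S\subseteq V$, $G|_S$ denotes the vertex induced subgraph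 on $S$. Unicycle: a directed graph is a unicycle if its edge set is a Hamiltonian cycle of it, i.e., its edges are exactly the edges of a single directed cycle visiting every vertex exactly once. Directed cycles have length at least $2$; a pair of opposite edges $i\to j$, $j\to i$ is a directed cycle of length $2$. An edge $e$ of $G$ "belongs to a unicycle" if there is $S\subseteq V$ such that $G|_S$ is a unicycle and $e$ is an edge of $G|_S$. MAIS (maximal acyclic induced subgraph) bound of a graph $H$ on vertex set $[1:n]$: the set of all nonnegative real tuples $(R_1,\dots,R_n)$ such that $\sum_{j\in S}R_j\le 1$ for every $S\subseteq[1:n]$ for which $H|_S$ is acyclic (contains no directed cycle). It is an outer bound: it contains the capacity region of $H$ (a known result). The MAIS bound is tight for $H$ if it equals the capacity region of $H$. *)

theory Defs
  imports "HOL-Analysis.Analysis"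
begin

text \<open>
  Receivers (= vertices) form a finite type \<open>'n\<close>, playing the role of \<open>{1, \<dots>, n}\<close> with
  \<open>n = CARD('n) \<ge> 1\<close>.  A side information graph is given by its edge relation; a pair
  \<open>(i, j)\<close> is the edge \<open>i \<rightarrow> j\<close>, meaning that receiver \<open>j\<close> knows message \<open>i\<close>.
\<close>

definition side_information_graph :: "('n \<times> 'n) set \<Rightarrow> bool" where
  "side_information_graph E \<longleftrightarrow> irrefl E"

definition side_info :: "('n \<times> 'n) set \<Rightarrow> 'n \<Rightarrow> 'n set" where
  "side_info E j = {i. (i, j) \<in> E}"

definition bits :: "nat \<Rightarrow> bool list set" where
  "bits k = {b. length b = k}"

text \<open>
  The encoder and decoders are total HOL functions, constrained only on the product sets that
  are their domains; a decoder sees exactly the codeword and the messages in its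
  side information set, the other coordinates being erased by \<^const>\<open>restrict\<close>.
\<close>

definition index_code ::
  "('n \<times> 'n) set \<Rightarrow> ('n \<Rightarrow> nat) \<Rightarrow> nat \<Rightarrow> (('n \<Rightarrow> bool list) \<Rightarrow> bool list) \<Rightarrow>
   ('n \<Rightarrow> bool list \<times> ('n \<Rightarrow> bool list) \<Rightarrow> bool list) \<Rightarrow> bool" where
  "index_code E t r \<phi> \<psi> \<longleftrightarrow>
     \<phi> \<in> (\<Pi>\<^sub>E i\<in>UNIV. bits (t i)) \<rightarrow> bits r \<and>
     (\<forall>j. \<psi> j \<in> bits r \<times> (\<Pi>\<^sub>E k\<in>side_info E j. bits (t k)) \<rightarrow> bits (t j)) \<and>
     (\<forall>j. \<forall>x \<in> (\<Pi>\<^sub>E i\<in>UNIV. bits (t i)). \<psi> j (\<phi> x, restrict x (side_info E j)) = x j)"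

definition achievable :: "('n::finite \<times> 'n) set \<Rightarrow> real ^ 'n \<Rightarrow> bool" where
  "achievable E R \<longleftrightarrow>
     (\<forall>j. 0 \<le> R $ j) \<and>
     (\<exists>t r \<phi> \<psi>. 0 < r \<and> index_code E t r \<phi> \<psi> \<and> (\<forall>j. R $ j \<le> real (t j) / real r))"

definition capacity_region :: "('n::finite \<times> 'n) set \<Rightarrow> (real ^ 'n) set" where
  "capacity_region E = closure {R. achievable E R}"

definition critical_edge :: "('n::finite \<times> 'n) set \<Rightarrow> 'n \<times> 'n \<Rightarrow> bool" where
  "critical_edge E e \<longleftrightarrow> e \<in> E \<and> capacity_region (E - {e}) \<subset> capacity_region E"

definition induced_edges :: "('n \<times> 'n) set \<Rightarrow> 'n set \<Rightarrow> ('n \<times> 'n) set" where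
  "induced_edges E S = E \<inter> (S \<times> S)"

text \<open>The graph with vertex set \<open>S\<close> and edge set \<open>F\<close> is a single directed Hamiltonian cycle.\<close>

definition unicycle :: "'n set \<Rightarrow> ('n \<times> 'n) set \<Rightarrow> bool" where
  "unicycle S F \<longleftrightarrow>
     (\<exists>vs. 2 \<le> length vs \<and> distinct vs \<and> set vs = S \<and>
           F = {(vs ! i, vs ! (Suc i mod length vs)) | i. i < length vs})"

definition belongs_to_unicycle :: "('n \<times> 'n) set \<Rightarrow> 'n \<times> 'n \<Rightarrow> bool" where
  "belongs_to_unicycle E e \<longleftrightarrow>
     (\<exists>S. unicycle S (induced_edges E S) \<and> e \<in> induced_edges E S)"

definition mais_bound :: "('n::finite \<times> 'n) set \<Rightarrow> (real ^ 'n) set" where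
  "mais_bound E =
     {R. (\<forall>j. 0 \<le> R $ j) \<and> (\<forall>S. acyclic (induced_edges E S) \<longrightarrow> (\<Sum>j\<in>S. R $ j) \<le> 1)}"

definition mais_tight :: "('n::finite \<times> 'n) set \<Rightarrow> bool" where
  "mais_tight E \<longleftrightarrow> mais_bound E = capacity_region E"

end

theory Submission imports Defs begin

text \<open>
  If an induced subgraph of \<open>G\<close> contains a cycle but becomes acyclic on removal of \<open>e\<close>, then a
  shortest cycle in it is chordless, hence a unicycle, and runs through \<open>e\<close>.  So if \<open>e\<close> belongs
  to no unicycle, then \<open>G\<close> and \<open>G\<^sub>e\<close> have the same acyclic induced subgraphs and the same MAIS
  bound.  Were that bound tight for \<open>G\<^sub>e\<close>, the capacity region of \<open>G\<close>, which lies within the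
  MAIS bound, would lie within that of \<open>G\<^sub>e\<close>, and \<open>e\<close> would not be critical.
\<close>

lemma induced_edges_mono: "E \<subseteq> E' \<Longrightarrow> S \<subseteq> S' \<Longrightarrow> induced_edges E S \<subseteq> induced_edges E' S'"
  by (auto simp: induced_edges_def)

lemma relpow_segment:
  assumes "\<And>i. i < n \<Longrightarrow> (g i, g (Suc i)) \<in> F" and "i + k \<le> n"
  shows "(g i, g (i + k)) \<in> F ^^ k"
  using assms(2) by (induction k) (auto intro!: relpow_Suc_I assms(1))

text \<open>Take a closed walk \<open>g\<close> of least positive length \<open>n\<close>. It need
  not be a simple cycle by definition, but a chord or a repeated vertex would close a shorter walk,
  so its vertices induce exactly its own edges.\<close>

lemma unicycle_if_not_acyclic:
  assumes "irrefl E" and cyc: "\<not> acyclic (induced_edges E S)"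
  obtains T where "T \<subseteq> S" "unicycle T (induced_edges E T)"
proof -
  define F where "F = induced_edges E S"
  define n where "n = (LEAST n. 0 < n \<and> (\<exists>x. (x, x) \<in> F ^^ n))"
  have ex: "\<exists>n. 0 < n \<and> (\<exists>x. (x, x) \<in> F ^^ n)"
    using cyc by (auto simp: acyclic_def F_def trancl_power)
  have "0 < n" and "\<exists>x. (x, x) \<in> F ^^ n"
    using LeastI_ex[OF ex] by (auto simp: n_def)
  then obtain g where closed: "g n = g 0" and edge: "\<And>i. i < n \<Longrightarrow> (g i, g (Suc i)) \<in> F"
    by (auto simp: relpow_fun_conv)
  have shortest: "n \<le> m" if "(x, x) \<in> F ^^ m" "0 < m" for x m
    using that unfolding n_def by (intro Least_le) auto
  have edge_mod: "(g i, g (Suc i mod n)) \<in> F" if "i < n" for i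
    using edge[OF that] that closed by (cases "Suc i = n") auto
  \<comment> \<open>The edge from \<open>g i\<close> to \<open>g j\<close> closes the stretch of the
    walk from \<open>g j\<close> on to \<open>g i\<close>, which passes through
    \<open>g n = g 0\<close> when \<open>i < j\<close>. By minimality the stretch has at least
    \<open>n - 1\<close> edges, so \<open>j\<close> can only be the cyclic successor of
    \<open>i\<close>.\<close>
  have chord: "j = Suc i mod n" if ij: "i < n" "j < n" and "(g i, g j) \<in> F" for i j
  proof (cases "j \<le> i")
    case True
    have "(g j, g (j + (i - j))) \<in> F ^^ (i - j)"
      by (rule relpow_segment[where n = n]) (use edge ij True in auto)
    then have "(g j, g j) \<in> F ^^ Suc (i - j)"
      using that True by (auto intro: relpow_Suc_I)
    then have "n \<le> Suc (i - j)"
      by (rule shortest) simp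
    then have "Suc i = n" "j = 0"
      using ij True by linarith+
    then show ?thesis by simp
  next
    case False
    have "(g j, g (j + (n - j))) \<in> F ^^ (n - j)"
      by (rule relpow_segment[where n = n]) (use edge ij in auto)
    moreover have "(g 0, g (0 + i)) \<in> F ^^ i"
      by (rule relpow_segment[where n = n]) (use edge ij in auto)
    ultimately have "(g j, g i) \<in> F ^^ (n - j + i)"
      using ij closed by (intro relpow_trans[where y = "g 0"]) simp_all
    then have "(g j, g j) \<in> F ^^ Suc (n - j + i)"
      using that by (auto intro: relpow_Suc_I)
    then have "n \<le> Suc (n - j + i)"
      by (rule shortest) simp
    then have "j = Suc i"
      using ij False by linarith
    then show ?thesis using ij by simp
  qed
  have inj: "inj_on g {..<n}"
  proof (rule inj_onI)
    fix i j assume ij: "i \<in> {..<n}" "j \<in> {..<n}" "g i = g j"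
    \<comment> \<open>\<open>p\<close> is the cyclic predecessor of \<open>j\<close>. As
      \<open>g i = g j\<close>, the edge from \<open>g p\<close> also ends in \<open>g i\<close>, so
      \<open>chord\<close> makes \<open>i\<close> the successor of \<open>p\<close> as well.\<close>
    define p where "p = (if j = 0 then n - 1 else j - 1)"
    have p: "p < n" "Suc p mod n = j"
      using ij \<open>0 < n\<close> by (auto simp: p_def)
    then have "(g p, g i) \<in> F"
      using edge_mod[of p] ij by simp
    then show "i = j"
      using chord[of p i] p ij by simp
  qed
  have "n \<noteq> 1"
    using edge[of 0] closed \<open>irrefl E\<close> by (auto simp: F_def induced_edges_def irrefl_def)
  define vs where "vs = map g [0..<n]"
  have sub: "set vs \<subseteq> S"
    using edge by (auto simp: vs_def F_def induced_edges_def)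
  have "unicycle (set vs) (induced_edges E (set vs))"
    unfolding unicycle_def
  proof (intro exI conjI)
    show "2 \<le> length vs"
      using \<open>0 < n\<close> \<open>n \<noteq> 1\<close> by (simp add: vs_def)
    show "distinct vs"
      using inj by (simp add: vs_def distinct_map atLeast0LessThan)
    have "induced_edges E (set vs) = F \<inter> set vs \<times> set vs"
      using sub by (auto simp: induced_edges_def F_def)
    also have "\<dots> = {(g i, g j) | i j. i < n \<and> j < n \<and> (g i, g j) \<in> F}"
      by (fastforce simp: vs_def)
    also have "\<dots> = {(g i, g (Suc i mod n)) | i. i < n}"
    proof (intro equalityI subsetI)
      fix z assume "z \<in> {(g i, g (Suc i mod n)) | i. i < n}"
      then obtain i where "z = (g i, g (Suc i mod n))" "i < n" by blast
      with edge_mod[of i] \<open>0 < n\<close> show "z \<in> {(g i, g j) | i j. i < n \<and> j < n \<and> (g i, g j) \<in> F}"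
        by (intro CollectI exI[of _ i] exI[of _ "Suc i mod n"]) simp
    qed (use chord in blast)
    also have "\<dots> = {(vs ! i, vs ! (Suc i mod length vs)) | i. i < length vs}"
      using \<open>0 < n\<close> by (intro Collect_cong ex_cong1) (auto simp: vs_def)
    finally show "induced_edges E (set vs) = \<dots>" .
  qed simp
  with sub show thesis by (rule that)
qed

lemma unicycle_not_acyclic:
  assumes "unicycle S F"
  shows "\<not> acyclic F"
proof
  assume ac: "acyclic F"
  obtain vs where vs: "2 \<le> length vs" "F = {(vs ! i, vs ! (Suc i mod length vs)) | i. i < length vs}"
    using assms unfolding unicycle_def by blast
  \<comment> \<open>Continuing the cycle periodically turns its closing edge into an ordinary step
    from \<open>g i\<close> to \<open>g (Suc i)\<close>.\<close>
  define g where "g i = vs ! (i mod length vs)" for i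
  have "i mod length vs < length vs" for i
    using vs(1) by (intro mod_less_divisor) linarith
  then have "(g i, g (Suc i)) \<in> F" for i
    unfolding vs(2) by (auto simp: g_def mod_Suc_eq intro!: exI[of _ "i mod length vs"])
  then have "(g 0, g (0 + length vs)) \<in> F ^^ length vs"
    by (intro relpow_segment[where n = "length vs"]) auto
  then have "(g 0, g 0) \<in> F\<^sup>+"
    using vs(1) unfolding trancl_power by (intro exI[of _ "length vs"]) (auto simp: g_def)
  with ac show False by (simp add: acyclic_def)
qed

lemma acyclic_induced_edges_remove:
  assumes "irrefl E" and "\<not> belongs_to_unicycle E e"
    and ac: "acyclic (induced_edges (E - {e}) S)"
  shows "acyclic (induced_edges E S)"
proof (rule ccontr)
  assume "\<not> acyclic (induced_edges E S)"
  with \<open>irrefl E\<close> obtain T where T: "T \<subseteq> S" "unicycle T (induced_edges E T)"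
    by (rule unicycle_if_not_acyclic)
  \<comment> \<open>The unicycle on \<open>T\<close> avoids \<open>e\<close>, so it survives the
    removal of \<open>e\<close> and still puts a cycle inside \<open>S\<close>.\<close>
  with assms(2) have "induced_edges E T = induced_edges (E - {e}) T"
    by (auto simp: belongs_to_unicycle_def induced_edges_def)
  with T have "\<not> acyclic (induced_edges (E - {e}) T)"
    by (metis unicycle_not_acyclic)
  with T(1) ac show False
    by (meson acyclic_subset induced_edges_mono subset_refl)
qed

lemma mais_bound_remove:
  assumes "irrefl E" and "\<not> belongs_to_unicycle E e"
  shows "mais_bound (E - {e}) = mais_bound E"
proof -
  have "acyclic (induced_edges (E - {e}) S) \<longleftrightarrow> acyclic (induced_edges E S)" for S
    using acyclic_induced_edges_remove[OF assms]
    by (meson Diff_subset acyclic_subset induced_edges_mono subset_refl)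
  then show ?thesis by (simp add: mais_bound_def)
qed

lemma card_bits: "card (bits k) = 2 ^ k"
  using card_lists_length_eq[of "UNIV :: bool set" k] by (simp add: bits_def card_UNIV_bool)

lemma finite_bits: "finite (bits k)"
  using finite_lists_length_eq[of "UNIV :: bool set" k] by (simp add: bits_def)

text \<open>
  With the messages outside \<open>S\<close> set to zero, the encoder is injective: two messages with the same
  codeword would first differ, in a topological order of \<open>S\<close>, at a receiver whose side information
  agrees.
\<close>

lemma index_code_sum_le:
  fixes E :: "('n::finite \<times> 'n) set"
  assumes code: "index_code E t r \<phi> \<psi>" and ac: "acyclic (induced_edges E S)"
  shows "(\<Sum>j\<in>S. t j) \<le> r"
proof -
  define B where "B i = (if i \<in> S then bits (t i) else {replicate (t i) False})" for i
  define X where "X = (\<Pi>\<^sub>E i\<in>UNIV. B i)"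
  have X: "X \<subseteq> (\<Pi>\<^sub>E i\<in>UNIV. bits (t i))"
    unfolding X_def by (intro PiE_mono) (simp add: B_def bits_def)
  have decode: "\<psi> j (\<phi> x, restrict x (side_info E j)) = x j" if "x \<in> X" for x j
    using code subsetD[OF X that] unfolding index_code_def by blast
  have wf: "wf (induced_edges E S)"
    using finite ac by (rule finite_acyclic_wf)
  have "inj_on \<phi> X"
  proof (rule inj_onI, rule ccontr)
    fix x y assume xy: "x \<in> X" "y \<in> X" "\<phi> x = \<phi> y" and "x \<noteq> y"
    from \<open>x \<noteq> y\<close> obtain k where "k \<in> {j. x j \<noteq> y j}" by auto
    with wf obtain j where j: "x j \<noteq> y j"
      and min: "\<And>i. (i, j) \<in> induced_edges E S \<Longrightarrow> x i = y i"
      by (rule wfE_min) auto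
    have outside: "x i = y i" if "i \<notin> S" for i
      using PiE_mem[OF xy(1)[unfolded X_def], of i] PiE_mem[OF xy(2)[unfolded X_def], of i] that
      by (simp add: B_def)
    \<comment> \<open>Here \<open>j\<close> lies in \<open>S\<close>, because \<open>x\<close> and
      \<open>y\<close> agree outside \<open>S\<close>. A known message inside \<open>S\<close>
      therefore comes along an induced edge and agrees by minimality of \<open>j\<close>.\<close>
    have "x i = y i" if "i \<in> side_info E j" for i
      using min[of i] outside j that by (auto simp: side_info_def induced_edges_def)
    then have "restrict x (side_info E j) = restrict y (side_info E j)"
      by (auto simp: restrict_def)
    with decode[of x j] decode[of y j] xy j show False by simp
  qed
  moreover have "\<phi> ` X \<subseteq> bits r"
    using code X unfolding index_code_def by blast
  ultimately have "card X \<le> card (bits r)"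
    by (rule card_inj_on_le[OF _ _ finite_bits])
  \<comment> \<open>Each frozen coordinate contributes a factor 1, so comparing cardinalities
    compares exponents of 2.\<close>
  moreover have "card X = (\<Prod>i\<in>UNIV. if i \<in> S then 2 ^ t i else 1)"
    by (auto simp: X_def card_PiE B_def card_bits intro!: prod.cong)
  moreover have "\<dots> = 2 ^ (\<Sum>i\<in>S. t i)"
    by (simp add: prod.If_cases power_sum)
  ultimately show ?thesis by (simp add: card_bits)
qed

lemma achievable_imp_mais_bound:
  assumes "achievable E R"
  shows "R \<in> mais_bound E"
proof -
  obtain t r \<phi> \<psi> where r: "0 < r" and code: "index_code E t r \<phi> \<psi>"
    and R: "\<And>j. R $ j \<le> real (t j) / real r" "\<And>j. 0 \<le> R $ j"
    using assms unfolding achievable_def by blast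
  have "(\<Sum>j\<in>S. R $ j) \<le> 1" if "acyclic (induced_edges E S)" for S
  proof -
    have "(\<Sum>j\<in>S. R $ j) \<le> (\<Sum>j\<in>S. real (t j) / real r)"
      by (intro sum_mono R)
    also have "\<dots> = real (\<Sum>j\<in>S. t j) / real r"
      by (simp add: sum_divide_distrib)
    also have "\<dots> \<le> 1"
      using index_code_sum_le[OF code that] r by (simp add: divide_le_eq del: of_nat_sum)
    finally show ?thesis .
  qed
  with R(2) show ?thesis by (simp add: mais_bound_def)
qed

text \<open>The bound is cut out by non-strict linear inequalities. Closedness carries it from
  achievable tuples to their closure, the capacity region.\<close>

lemma closed_mais_bound: "closed (mais_bound E)"
  unfolding mais_bound_def
  by (intro closed_Collect_conj closed_Collect_all closed_Collect_imp closed_Collect_le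
      open_Collect_const continuous_intros)

lemma capacity_region_subset_mais_bound: "capacity_region E \<subseteq> mais_bound E"
  unfolding capacity_region_def
  by (rule closure_minimal[OF _ closed_mais_bound]) (auto intro: achievable_imp_mais_bound)

theorem theorem2:
  fixes E :: "('n::finite \<times> 'n) set" and e :: "'n \<times> 'n"
  assumes "side_information_graph E"
    and "e \<in> E"
    and "critical_edge E e"
  shows "belongs_to_unicycle E e \<or>
         (\<not> belongs_to_unicycle E e \<and> \<not> mais_tight (E - {e}))"
proof (cases "belongs_to_unicycle E e")
  case False
  have "\<not> mais_tight (E - {e})"
  proof
    assume "mais_tight (E - {e})"
    then have "capacity_region (E - {e}) = mais_bound E"
      using mais_bound_remove[OF _ False] assms(1)
      by (simp add: mais_tight_def side_information_graph_def)
    with capacity_region_subset_mais_bound[of E] assms(3) show False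
      by (auto simp: critical_edge_def)
  qed
  with False show ?thesis by simp
qed simp

end
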